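(* Let $q$ be a non-zero real number, and let $P_n(\omega_1,\omega_2)$ denote the path on $n$ vertices with potentials $\omega_1$ and $\omega_2$ assigned only at the two end vertices (one each). Then $P_n(\omega_1,\omega_2)$ does not exhibit vertex perfect state transfer with respect to its $q$-Laplacian matrix in any of the following cases: 1. $n\ge 2$ with $\omega_1=1+\frac1q$ and $\omega_2=1$; 2. $n\ge 4$ with $\omega_1=\omega_2=1$; 3. $n\ge 5$ with $\omega_1=\omega_2=1+\frac1q$.
   Context: The path on vertices $1,\dots,n$ ($j,k$ adjacent iff $|j-k|=1$) has adjacency matrix $A$ and diagonal degree matrix $\Delta$. $P_n(\omega_1,\omega_2)$ has potential $\omega_1$ at vertex $1$ and $\omega_2$ at vertex $n$; with $\Delta'=\omega_1\mathbf{e}_1\mathbf{e}_1^T+\omega_2\mathbf{e}_n\mathbf{e}_n^T$, its $q$-Laplacian matrix is $\mathscr{L}=(1-q^2)I+q^2(\Delta+\Delta')-qA$. Here $\mathbf{e}_u$ is the characteristic vector of $u$. Vertex perfect state transfer means there are distinct vertices $u,v$, some $\tau>0$ and $\gamma\in\mathbb{C}$ with $\exp(i\tau\mathscr{L})\mathbf{e}_u=\gamma\mathbf{e}_v$. *)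

theory Defs
  imports Complex_Main "Jordan_Normal_Form.Matrix"
begin

(* Matrices are indexed from 0, so the vertices 1, ..., n of the path appear as 0, ..., n - 1;
   the two end vertices are 0 and n - 1. *)

definition path_adj :: "nat \<Rightarrow> nat \<Rightarrow> bool" where
  "path_adj j k \<longleftrightarrow> \<bar>int j - int k\<bar> = 1"

definition adjacency_mat :: "nat \<Rightarrow> (nat \<Rightarrow> nat \<Rightarrow> bool) \<Rightarrow> real mat" where
  "adjacency_mat n E = mat n n (\<lambda>(j, k). if E j k then 1 else 0)"

definition degree_mat :: "nat \<Rightarrow> (nat \<Rightarrow> nat \<Rightarrow> bool) \<Rightarrow> real mat" where
  "degree_mat n E = mat n n (\<lambda>(j, k). if j = k then real (card {l. l < n \<and> E j l}) else 0)"

definition outer_prod :: "real vec \<Rightarrow> real vec \<Rightarrow> real mat" where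
  "outer_prod v w = mat (dim_vec v) (dim_vec w) (\<lambda>(j, k). v $ j * w $ k)"

definition end_potential_mat :: "nat \<Rightarrow> real \<Rightarrow> real \<Rightarrow> real mat" where
  "end_potential_mat n \<omega>\<^sub>1 \<omega>\<^sub>2 =
     \<omega>\<^sub>1 \<cdot>\<^sub>m outer_prod (unit_vec n 0) (unit_vec n 0) +
     \<omega>\<^sub>2 \<cdot>\<^sub>m outer_prod (unit_vec n (n - 1)) (unit_vec n (n - 1))"

definition path_q_laplacian :: "real \<Rightarrow> nat \<Rightarrow> real \<Rightarrow> real \<Rightarrow> real mat" where
  "path_q_laplacian q n \<omega>\<^sub>1 \<omega>\<^sub>2 =
     (1 - q\<^sup>2) \<cdot>\<^sub>m 1\<^sub>m n
     + q\<^sup>2 \<cdot>\<^sub>m (degree_mat n path_adj + end_potential_mat n \<omega>\<^sub>1 \<omega>\<^sub>2)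
     - q \<cdot>\<^sub>m adjacency_mat n path_adj"

(* The exponential power series, summed entrywise; lemma mat_exp_sums below shows that every
   entry converges for a square matrix. *)
definition mat_exp :: "complex mat \<Rightarrow> complex mat" where
  "mat_exp M = mat (dim_row M) (dim_row M) (\<lambda>(j, k). \<Sum>m. (M ^\<^sub>m m) $$ (j, k) / fact m)"

definition vertex_PST :: "real mat \<Rightarrow> bool" where
  "vertex_PST L \<longleftrightarrow>
     (\<exists>u < dim_row L. \<exists>v < dim_row L. u \<noteq> v \<and>
       (\<exists>\<tau> :: real. \<tau> > 0 \<and> (\<exists>\<gamma> :: complex.
         mat_exp ((\<i> * complex_of_real \<tau>) \<cdot>\<^sub>m map_mat complex_of_real L)
             *\<^sub>v unit_vec (dim_row L) u
           = \<gamma> \<cdot>\<^sub>v unit_vec (dim_row L) v)))"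

lemma path_q_laplacian_carrier: "path_q_laplacian q n \<omega>\<^sub>1 \<omega>\<^sub>2 \<in> carrier_mat n n"
  by (auto simp: path_q_laplacian_def end_potential_mat_def outer_prod_def
      degree_mat_def adjacency_mat_def)

lemma norm_pow_mat_le:
  fixes M :: "complex mat"
  assumes M: "M \<in> carrier_mat n n"
    and c: "\<And>j k. j < n \<Longrightarrow> k < n \<Longrightarrow> norm (M $$ (j, k)) \<le> c"
    and jk: "j < n" "k < n"
  shows "norm ((M ^\<^sub>m m) $$ (j, k)) \<le> (real n * c) ^ m"
  using jk(2)
proof (induction m arbitrary: k)
  case 0
  then show ?case using M jk(1) by auto
next
  case (Suc m)
  have c0: "0 \<le> c" using c[OF jk] norm_ge_zero order_trans by blast
  have car: "M ^\<^sub>m m \<in> carrier_mat n n" using M by simp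
  have "(M ^\<^sub>m Suc m) $$ (j, k) = (\<Sum>l<n. (M ^\<^sub>m m) $$ (j, l) * M $$ (l, k))"
    using M car jk(1) Suc.prems by (auto simp: scalar_prod_def atLeast0LessThan)
  also have "norm \<dots> \<le> (\<Sum>l<n. (real n * c) ^ m * c)"
  proof (rule sum_norm_le)
    fix l assume "l \<in> {..<n}"
    then have "norm ((M ^\<^sub>m m) $$ (j, l)) \<le> (real n * c) ^ m" "norm (M $$ (l, k)) \<le> c"
      using Suc.IH c Suc.prems by auto
    then show "norm ((M ^\<^sub>m m) $$ (j, l) * M $$ (l, k)) \<le> (real n * c) ^ m * c"
      unfolding norm_mult using c0 by (intro mult_mono) auto
  qed
  also have "\<dots> = (real n * c) ^ Suc m" by simp
  finally show ?case .
qed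

lemma mat_exp_sums:
  assumes M: "M \<in> carrier_mat n n" and jk: "j < n" "k < n"
  shows "(\<lambda>m. (M ^\<^sub>m m) $$ (j, k) / fact m) sums (mat_exp M $$ (j, k))"
proof -
  define c where "c = Max ((\<lambda>(j, k). norm (M $$ (j, k))) ` ({..<n} \<times> {..<n}))"
  have c: "norm (M $$ (j, k)) \<le> c" if "j < n" "k < n" for j k
    unfolding c_def using that by (intro Max_ge) auto
  have "summable (\<lambda>m. (real n * c) ^ m / fact m)"
    using summable_exp[of "real n * c"] by (simp add: field_simps)
  then have "summable (\<lambda>m. (M ^\<^sub>m m) $$ (j, k) / fact m)"
    by (rule summable_comparison_test') 
      (simp add: norm_divide divide_right_mono norm_pow_mat_le[OF M c jk])
  then show ?thesis
    using M jk by (auto simp: mat_exp_def summable_sums)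
qed

end

theory Submission
  imports Defs "HOL-Computational_Algebra.Polynomial" "HOL-Library.Real_Mod"
begin

text \<open>
  Every interior diagonal entry of the \<open>q\<close>-Laplacian is \<open>1 + q\<^sup>2\<close>, and the two admissible
  potentials turn its eigenvalue equation into the wave recurrence
  \<open>y (j - 1) + y (j + 1) = \<theta> y j\<close> on the vertices \<open>1, \<dots>, n\<close> with a reflecting condition at each end:
  potential \<open>1\<close> forces \<open>y\<close> to vanish at the virtual neighbour of the end vertex, and potential
  \<open>1 + 1/q\<close> forces \<open>y\<close> to be antisymmetric about the point half a step outside it. So the
  eigenvectors are standing sine waves between two walls (\<open>wall\<close>): with \<open>t\<close> equal to \<open>\<pi>\<close> divided by
  the distance of the walls, the wave \<open>y\<^sub>k j = sin (k t (j - s))\<close> has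
  \<open>\<theta>\<^sub>k = 2 cos (k t)\<close> and the eigenvalue of the \<open>q\<close>-Laplacian is \<open>1 + q\<^sup>2 - q \<theta>\<^sub>k\<close>.

  Pairing the exponential with an eigenvector turns perfect state transfer from \<open>u\<close> to \<open>v\<close> into one
  scalar equation per wave. Its absolute value for \<open>k = 1, 2\<close> shows that \<open>u\<close> and \<open>v\<close> are
  mirror images of each other between the walls; its phase shows that the differences
  \<open>\<theta>\<^sub>k - \<theta>\<^sub>l\<close> are integer multiples of one number, for all waves that do not vanish at \<open>u\<close>
  (\<open>path_PST_mirror_commensurable\<close>). If the two walls are of different kinds, the mirror image of a
  vertex is not a vertex, which settles the first case for every \<open>n\<close>.

  In the other two cases the \<open>\<theta>\<^sub>k\<close> are polynomials in \<open>x = 2 cos (\<pi> / N)\<close>, where \<open>N\<close> is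
  \<open>n + 1\<close> or \<open>n\<close> and hence \<open>N \<ge> 5\<close>. The integer multiples yield rational functions
  of \<open>x\<close> with rational values, and a few waves suffice to conclude that \<open>x\<close> itself is rational.
  But \<open>x\<close> is an algebraic integer with \<open>1 < x < 2\<close>, so it is irrational.
\<close>

section \<open>Arithmetic of the numbers 2 cos (pi / N)\<close>

text \<open>
  The Chebyshev polynomials rescaled to be monic with integer coefficients: \<open>dickson_poly k\<close>
  expresses \<open>2 cos (k t)\<close> in terms of \<open>2 cos t\<close>.
\<close>

fun dickson_poly :: "nat \<Rightarrow> real poly" where
  "dickson_poly 0 = [:2:]"
| "dickson_poly (Suc 0) = [:0, 1:]"
| "dickson_poly (Suc (Suc k)) = pCons 0 (dickson_poly (Suc k)) - dickson_poly k"

lemma two_cos_step: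
  "2 * cos (real (Suc (Suc k)) * t)
     = 2 * cos t * (2 * cos (real (Suc k) * t)) - 2 * cos (real k * t)"
proof -
  have "cos (real (Suc k) * t + t) + cos (real (Suc k) * t - t) = 2 * cos (real (Suc k) * t) * cos t"
    by (simp add: cos_add cos_diff)
  then show ?thesis by (simp add: algebra_simps)
qed

lemma poly_dickson_poly: "poly (dickson_poly k) (2 * cos t) = 2 * cos (real k * t)"
proof (induction k rule: dickson_poly.induct)
  case (3 k)
  then show ?case unfolding two_cos_step by simp
qed auto

lemma coeff_dickson_poly_Ints: "coeff (dickson_poly k) i \<in> \<int>"
  by (induction k arbitrary: i rule: dickson_poly.induct) (auto simp: coeff_pCons split: nat.splits)

lemma dickson_poly_monic:
  "degree (dickson_poly k) \<le> k \<and> (k > 0 \<longrightarrow> coeff (dickson_poly k) k = 1)"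
proof (induction k rule: dickson_poly.induct)
  case (3 k)
  have "degree (pCons 0 (dickson_poly (Suc k)) - dickson_poly k) \<le> Suc (Suc k)"
    using 3 by (intro degree_diff_le) (auto intro: degree_pCons_le le_trans)
  moreover have "coeff (dickson_poly k) (Suc (Suc k)) = 0"
    using 3 by (intro coeff_eq_0) auto
  ultimately show ?case using 3 by simp
qed auto

text \<open>
  Since \<open>2 cos (N \<cdot> \<pi> / N) = -2\<close>, the number is a root of the monic integer polynomial
  \<open>dickson_poly N + 2\<close>.
\<close>

lemma algebraic_int_two_cos_pi_div:
  assumes "N > 0"
  shows "algebraic_int (2 * cos (pi / real N))"
proof (rule algebraic_int.intros)
  let ?p = "dickson_poly N + [:2:]"
  have c: "coeff ?p N = 1"
    using assms dickson_poly_monic[of N] by (cases N) auto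
  have "degree ?p \<le> N"
    using dickson_poly_monic[of N] by (intro degree_add_le) auto
  with c have "degree ?p = N"
    by (metis le_antisym le_degree zero_neq_one)
  with c show "lead_coeff ?p = 1" by simp
  show "\<forall>i. coeff ?p i \<in> \<int>"
    by (auto simp: coeff_dickson_poly_Ints coeff_pCons split: nat.splits)
  show "poly ?p (2 * cos (pi / real N)) = 0"
    using assms by (simp add: poly_dickson_poly)
qed

text \<open>
  The bounds locate \<open>x\<close> strictly between two consecutive integers; \<open>2 < x\<^sup>2\<close>, which just says that
  the angle is below \<open>\<pi> / 4\<close>, later keeps denominators away from zero. It fails for \<open>N = 4\<close>.
\<close>

lemma two_cos_pi_div_bounds:
  assumes "N \<ge> 5"
  defines "x \<equiv> 2 * cos (pi / real N)"
  shows "1 < x" "x < 2" "2 < x\<^sup>2"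
proof -
  have N: "0 < pi / real N" "pi / real N < pi / 4"
    using assms by (auto simp: field_simps)
  then have Npi: "pi / real N \<le> pi" using pi_gt_zero by linarith
  have "cos (pi / 4) < cos (pi / real N)"
    using N by (intro cos_monotone_0_pi) auto
  then have s: "sqrt 2 < x" by (simp add: x_def cos_45)
  then have "(sqrt 2)\<^sup>2 < x\<^sup>2" by (intro power_strict_mono) auto
  then show "2 < x\<^sup>2" by simp
  show "1 < x" using s real_sqrt_gt_1_iff[of 2] by linarith
  have "cos (pi / real N) < cos 0"
    using N Npi by (intro cos_monotone_0_pi) auto
  then show "x < 2" by (simp add: x_def)
qed

lemma two_cos_pi_div_irrational:
  assumes "N \<ge> 5"
  shows "2 * cos (pi / real N) \<notin> \<rat>"
proof
  assume "2 * cos (pi / real N) \<in> \<rat>"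
  then have "2 * cos (pi / real N) \<in> \<int>"
    using assms by (intro rational_algebraic_int_is_int algebraic_int_two_cos_pi_div) auto
  then obtain m :: int where "2 * cos (pi / real N) = of_int m"
    by (elim Ints_cases)
  with two_cos_pi_div_bounds[OF assms] show False by simp
qed

section \<open>Eigenvectors of the path\<close>

lemma path_q_laplacian_entry:
  assumes "n \<ge> 2" "j < n" "k < n"
  shows "path_q_laplacian q n \<omega>\<^sub>1 \<omega>\<^sub>2 $$ (j, k) =
      (if j = k then 1 + q\<^sup>2 + (if k = 0 then q\<^sup>2 * (\<omega>\<^sub>1 - 1) else 0)
                     + (if k = n - 1 then q\<^sup>2 * (\<omega>\<^sub>2 - 1) else 0) else 0)
      - (if k = Suc j then q else 0) - (if j = Suc k then q else 0)"
proof -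
  have "{l. l < n \<and> path_adj k l}
      = (if k = 0 then {} else {k - 1}) \<union> (if k = n - 1 then {} else {Suc k})"
    using assms by (auto simp: path_adj_def split: if_splits)
  then have "real (card {l. l < n \<and> path_adj k l})
      = 2 - (if k = 0 then 1 else 0) - (if k = n - 1 then 1 else 0)"
    using assms by (auto simp: card_insert_if)
  moreover have "path_adj j k \<longleftrightarrow> k = Suc j \<or> j = Suc k"
    by (auto simp: path_adj_def)
  ultimately show ?thesis
    using assms
    by (auto simp: path_q_laplacian_def degree_mat_def end_potential_mat_def outer_prod_def
        adjacency_mat_def algebra_simps)
qed

text \<open>
  The vertices \<open>0, \<dots>, n - 1\<close> carry the values \<open>y 1, \<dots>, y n\<close>; the two extra
  values \<open>y 0\<close> and \<open>y (n + 1)\<close> sit on virtual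
  neighbours of the end vertices. The boundary conditions make the virtual terms of the recurrence
  equal to the contributions of the potentials. Left eigenvectors are used because they
  pair directly with the columns of the matrix exponential.
\<close>

lemma path_q_laplacian_left_eigenvector:
  fixes y :: "nat \<Rightarrow> real"
  assumes n: "n \<ge> 2"
    and rec: "\<And>j. y j + y (Suc (Suc j)) = \<theta> * y (Suc j)"
    and left: "y 0 = - (q * (\<omega>\<^sub>1 - 1)) * y 1"
    and right: "y (Suc n) = - (q * (\<omega>\<^sub>2 - 1)) * y n"
    and k: "k < n"
  shows "(\<Sum>j<n. y (Suc j) * path_q_laplacian q n \<omega>\<^sub>1 \<omega>\<^sub>2 $$ (j, k))
           = (1 + q\<^sup>2 - q * \<theta>) * y (Suc k)"
proof -
  define d where "d = 1 + q\<^sup>2 + (if k = 0 then q\<^sup>2 * (\<omega>\<^sub>1 - 1) else 0)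
                     + (if k = n - 1 then q\<^sup>2 * (\<omega>\<^sub>2 - 1) else 0)"
  have "(\<Sum>j<n. y (Suc j) * path_q_laplacian q n \<omega>\<^sub>1 \<omega>\<^sub>2 $$ (j, k))
      = (\<Sum>j<n. (if j = k then d * y (Suc k) else 0)
           - (if j = k - 1 then (if k = 0 then 0 else q * y k) else 0)
           - (if j = Suc k then q * y (Suc (Suc k)) else 0))"
    using n k by (intro sum.cong refl)
      (subst path_q_laplacian_entry, auto simp: d_def algebra_simps)
  also have "\<dots> = d * y (Suc k) - (if k = 0 then 0 else q * y k)
           - (if Suc k < n then q * y (Suc (Suc k)) else 0)"
    using k by (simp add: sum_subtractf sum.delta)
  also have "\<dots> = (1 + q\<^sup>2) * y (Suc k) - q * (y k + y (Suc (Suc k)))"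
  proof -
    have l: "q\<^sup>2 * (\<omega>\<^sub>1 - 1) * y (Suc k) = - q * y k" if "k = 0"
      using that by (simp add: left power2_eq_square)
    have r: "q\<^sup>2 * (\<omega>\<^sub>2 - 1) * y (Suc k) = - q * y (Suc (Suc k))" if "k = n - 1"
    proof -
      from that n have "n = Suc k" by simp
      then show ?thesis using right by (simp add: power2_eq_square)
    qed
    have "d * y (Suc k) = (1 + q\<^sup>2) * y (Suc k) - (if k = 0 then q * y k else 0)
        - (if k = n - 1 then q * y (Suc (Suc k)) else 0)"
      using l r unfolding d_def by (auto simp: distrib_right)
    moreover have "Suc k < n \<longleftrightarrow> k \<noteq> n - 1" using k by auto
    ultimately show ?thesis by (auto simp: algebra_simps)
  qed
  also have "\<dots> = (1 + q\<^sup>2 - q * \<theta>) * y (Suc k)"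
    by (simp add: rec algebra_simps)
  finally show ?thesis .
qed

section \<open>Perfect state transfer and left eigenvectors\<close>

lemma mat_exp_left_eigenvector:
  fixes M :: "complex mat"
  assumes M: "M \<in> carrier_mat n n"
    and eig: "\<And>k. k < n \<Longrightarrow> (\<Sum>j<n. x j * M $$ (j, k)) = \<mu> * x k"
    and k: "k < n"
  shows "(\<Sum>j<n. x j * mat_exp M $$ (j, k)) = exp \<mu> * x k"
proof -
  have pow: "(\<Sum>j<n. x j * (M ^\<^sub>m m) $$ (j, k)) = \<mu> ^ m * x k" if "k < n" for m k
    using that
  proof (induction m arbitrary: k)
    case 0
    have "(\<Sum>j<n. x j * (M ^\<^sub>m 0) $$ (j, k)) = (\<Sum>j<n. if j = k then x j else 0)"
      using M 0 by (intro sum.cong) auto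
    then show ?case using 0 by simp
  next
    case (Suc m)
    have "(\<Sum>j<n. x j * (M ^\<^sub>m Suc m) $$ (j, k))
        = (\<Sum>j<n. \<Sum>l<n. x j * (M ^\<^sub>m m) $$ (j, l) * M $$ (l, k))"
      using M Suc.prems
      by (intro sum.cong) (auto simp: scalar_prod_def atLeast0LessThan sum_distrib_left mult.assoc)
    also have "\<dots> = (\<Sum>l<n. (\<Sum>j<n. x j * (M ^\<^sub>m m) $$ (j, l)) * M $$ (l, k))"
      by (subst sum.swap) (simp add: sum_distrib_right)
    also have "\<dots> = \<mu> ^ m * (\<Sum>l<n. x l * M $$ (l, k))"
      unfolding sum_distrib_left using Suc.IH by (intro sum.cong) auto
    finally show ?case by (simp add: eig Suc.prems)
  qed
  have "(\<lambda>m. \<Sum>j<n. x j * ((M ^\<^sub>m m) $$ (j, k) / fact m)) sums (\<Sum>j<n. x j * mat_exp M $$ (j, k))"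
    using M k by (intro sums_sum sums_mult mat_exp_sums) auto
  moreover have "(\<lambda>m. \<Sum>j<n. x j * ((M ^\<^sub>m m) $$ (j, k) / fact m))
      = (\<lambda>m. \<mu> ^ m /\<^sub>R fact m * x k)"
  proof
    fix m
    have "(\<Sum>j<n. x j * ((M ^\<^sub>m m) $$ (j, k) / fact m))
        = (\<Sum>j<n. x j * (M ^\<^sub>m m) $$ (j, k)) / fact m"
      by (simp add: sum_divide_distrib)
    then show "(\<Sum>j<n. x j * ((M ^\<^sub>m m) $$ (j, k) / fact m)) = \<mu> ^ m /\<^sub>R fact m * x k"
      by (simp add: pow[OF k] scaleR_conv_of_real field_simps)
  qed
  moreover have "(\<lambda>m. \<mu> ^ m /\<^sub>R fact m * x k) sums (exp \<mu> * x k)"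
    by (intro sums_mult2 exp_converges)
  ultimately show ?thesis by (simp only: sums_unique2)
qed

text \<open>
  Pairing both sides of the transfer equation with a left eigenvector \<open>x\<close> for the eigenvalue \<open>\<mu>\<close>
  replaces the matrix exponential by the scalar \<open>cis (\<tau> * \<mu>)\<close> and leaves one entry of \<open>x\<close> on
  each side.
\<close>

lemma vertex_PST_eigenvector_relation:
  assumes L: "L \<in> carrier_mat n n" and "vertex_PST L"
  obtains u v \<tau> \<gamma> where "u < n" "v < n" "u \<noteq> v" "\<tau> > 0"
    "\<forall>x \<mu>. (\<forall>k<n. (\<Sum>j<n. x j * L $$ (j, k)) = \<mu> * x k) \<longrightarrow>
        cis (\<tau> * \<mu>) * complex_of_real (x u) = \<gamma> * complex_of_real (x v)"
proof -
  from assms obtain u v \<tau> \<gamma> where uv: "u < n" "v < n" "u \<noteq> v" "\<tau> > 0"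
    and eq: "mat_exp ((\<i> * complex_of_real \<tau>) \<cdot>\<^sub>m map_mat complex_of_real L)
             *\<^sub>v unit_vec n u = \<gamma> \<cdot>\<^sub>v unit_vec n v"
    by (auto simp: vertex_PST_def)
  let ?M = "(\<i> * complex_of_real \<tau>) \<cdot>\<^sub>m map_mat complex_of_real L"
  have M: "?M \<in> carrier_mat n n" using L by simp
  have E: "mat_exp ?M $$ (j, u) = (if j = v then \<gamma> else 0)" if "j < n" for j
  proof -
    have "mat_exp ?M $$ (j, u) = (mat_exp ?M *\<^sub>v unit_vec n u) $ j"
      using M that uv L by (simp add: mat_exp_def)
    also have "\<dots> = (if j = v then \<gamma> else 0)"
      unfolding eq using that uv by simp
    finally show ?thesis .
  qed
  have "cis (\<tau> * \<mu>) * complex_of_real (x u) = \<gamma> * complex_of_real (x v)"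
    if eig: "\<And>k. k < n \<Longrightarrow> (\<Sum>j<n. x j * L $$ (j, k)) = \<mu> * x k" for x \<mu>
  proof -
    have "(\<Sum>j<n. complex_of_real (x j) * mat_exp ?M $$ (j, u))
        = exp (\<i> * complex_of_real \<tau> * \<mu>) * complex_of_real (x u)"
    proof (rule mat_exp_left_eigenvector[OF M _ uv(1)])
      fix k assume k: "k < n"
      have "(\<Sum>j<n. complex_of_real (x j) * ?M $$ (j, k))
          = \<i> * \<tau> * complex_of_real (\<Sum>j<n. x j * L $$ (j, k))"
        using L k by (simp add: sum_distrib_left mult_ac)
      then show "(\<Sum>j<n. complex_of_real (x j) * ?M $$ (j, k))
          = \<i> * \<tau> * \<mu> * complex_of_real (x k)"
        by (simp add: eig[OF k])
    qed
    moreover have "(\<Sum>j<n. complex_of_real (x j) * mat_exp ?M $$ (j, u))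
        = (\<Sum>j<n. if j = v then complex_of_real (x j) * \<gamma> else 0)"
      by (intro sum.cong) (auto simp: E)
    ultimately show ?thesis
      using uv by (simp add: cis_conv_exp mult_ac)
  qed
  with uv that show ?thesis by blast
qed

section \<open>Transfer on a path between two walls\<close>

text \<open>
  An end vertex with potential \<open>\<omega>\<close> reflects waves as a zero at distance \<open>1 - s\<close> beyond that vertex
  does: on the virtual neighbour for \<open>s = 0\<close>, half a step outside the path for \<open>s = 1 / 2\<close>.
\<close>

definition wall :: "real \<Rightarrow> real \<Rightarrow> real \<Rightarrow> bool" where
  "wall q \<omega> s \<longleftrightarrow> (s = 0 \<and> \<omega> = 1) \<or> (s = 1 / 2 \<and> \<omega> = 1 + 1 / q)"

text \<open>
  This is the boundary condition of an eigenvector for a wave that vanishes at the wall; seen from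
  the wall, the end vertex is at position \<open>1 - s\<close> and its virtual neighbour at \<open>-s\<close>.
\<close>

lemma sin_wall:
  assumes "wall q \<omega> s" "q \<noteq> 0"
  shows "sin (a * (0 - s)) = - (q * (\<omega> - 1)) * sin (a * (1 - s))"
proof -
  from assms consider "s = 0" "\<omega> = 1" | "s = 1 / 2" "q * (\<omega> - 1) = 1"
    by (auto simp: wall_def)
  then show ?thesis
  proof cases
    case 2
    have "a * (0 - 1 / 2) = - (a * (1 - 1 / 2))" by simp
    then have "sin (a * (0 - 1 / 2)) = - sin (a * (1 - 1 / 2))" by (simp only: sin_minus)
    then show ?thesis unfolding 2 by simp
  qed simp
qed

text \<open>
  Doubling the angle contributes a factor \<open>2 cos\<close>, so the common ratio \<open>g\<close> cancels and the cosines
  agree up to sign. The ratio \<open>g\<close> stands for the modulus of the transfer amplitude.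
\<close>

lemma sin_abs_ratio_supplement:
  assumes a: "0 < a" "a < pi" and b: "0 < b" "b < pi" and "a \<noteq> b"
    and s1: "\<bar>sin a\<bar> = g * \<bar>sin b\<bar>" and s2: "\<bar>sin (2 * a)\<bar> = g * \<bar>sin (2 * b)\<bar>"
  shows "b = pi - a"
proof -
  have pos: "sin a > 0" "sin b > 0" using a b by (auto intro: sin_gt_zero)
  have "2 * \<bar>sin a\<bar> * \<bar>cos a\<bar> = g * (2 * \<bar>sin b\<bar> * \<bar>cos b\<bar>)"
    using s2 by (simp add: sin_double abs_mult)
  also have "\<dots> = 2 * \<bar>sin a\<bar> * \<bar>cos b\<bar>" by (simp add: s1)
  finally have "\<bar>cos a\<bar> = \<bar>cos b\<bar>" using pos by simp
  then consider "cos a = cos b" | "cos a = cos (pi - b)"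
    by (auto simp: abs_eq_iff cos_diff)
  then show ?thesis
  proof cases
    case 1
    then show ?thesis using a b \<open>a \<noteq> b\<close> cos_inj_pi[of a b] by simp
  next
    case 2
    then show ?thesis using a b cos_inj_pi[of a "pi - b"] by simp
  qed
qed

lemma sin_mult_supplement: "sin (real k * (pi - a)) = - ((-1) ^ k) * sin (real k * a)"
proof -
  have "sin (real k * (pi - a)) = sin (real k * pi - real k * a)"
    by (simp add: algebra_simps)
  also have "\<dots> = - ((-1) ^ k) * sin (real k * a)"
    by (simp add: sin_diff mult.commute[of "real k" pi])
  finally show ?thesis .
qed

text \<open>
  The position of the sites between the walls is measured by the angle \<open>\<alpha>\<close>, which runs from \<open>0\<close> at the
  left wall to \<open>\<pi>\<close> at the right one. Waves 1 and 2 force \<open>\<alpha> v = \<pi> - \<alpha> u\<close>, so that wave \<open>k\<close> has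
  the same value at \<open>u\<close> and \<open>v\<close> up to the sign \<open>-(-1)\<^sup>k\<close>. Where that value is not zero,
  squaring removes the sign and \<open>cis (2 \<tau> \<lambda>\<^sub>k) = \<gamma>\<^sup>2\<close> for the eigenvalue \<open>\<lambda>\<^sub>k\<close> of that wave; any two
  such eigenvalues differ by a multiple of \<open>\<pi> / \<tau>\<close>. Indices \<open>k\<close> beyond \<open>n\<close> are harmless: the wave is
  then zero or repeats an earlier one up to sign, but it still satisfies the eigenvector equation.
\<close>

lemma path_PST_mirror_commensurable:
  assumes q: "q \<noteq> 0" and n: "n \<ge> 2"
    and walls: "wall q \<omega>\<^sub>1 s" "wall q \<omega>\<^sub>2 s'"
    and t: "t * (real n + 1 - s - s') = pi"
    and pst: "vertex_PST (path_q_laplacian q n \<omega>\<^sub>1 \<omega>\<^sub>2)"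
  obtains u v c where "u < n" "v < n" "u \<noteq> v" "real u + real v + 1 = real n + s - s'"
    "c \<noteq> 0"
    "\<forall>k l. sin (real k * (t * (real u + 1 - s))) \<noteq> 0 \<longrightarrow>
           sin (real l * (t * (real u + 1 - s))) \<noteq> 0 \<longrightarrow>
        (\<exists>m::int. 2 * cos (real k * t) - 2 * cos (real l * t) = of_int m * c)"
proof -
  let ?L = "path_q_laplacian q n \<omega>\<^sub>1 \<omega>\<^sub>2"
  define \<alpha> where "\<alpha> = (\<lambda>j::nat. t * (real j + 1 - s))"
  define ev where "ev = (\<lambda>k::nat. 1 + q\<^sup>2 - q * (2 * cos (real k * t)))"
  have s: "0 \<le> s" "s \<le> 1 / 2" "0 \<le> s'" "s' \<le> 1 / 2"
    using walls by (auto simp: wall_def)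
  have tpos: "t > 0"
  proof (rule ccontr)
    assume "\<not> t > 0"
    then have "t * (real n + 1 - s - s') \<le> 0" using s n by (intro mult_nonpos_nonneg) auto
    with t pi_gt_zero show False by simp
  qed
  have eig: "(\<Sum>j<n. sin (real k * \<alpha> j) * ?L $$ (j, i)) = ev k * sin (real k * \<alpha> i)"
    if "i < n" for i k
  proof -
    define a where "a = real k * t"
    define y where "y = (\<lambda>j::nat. sin (a * (real j - s)))"
    have y_Suc: "y (Suc j) = sin (real k * \<alpha> j)" for j
      by (simp add: y_def a_def \<alpha>_def algebra_simps)
    have "(\<Sum>j<n. y (Suc j) * ?L $$ (j, i)) = (1 + q\<^sup>2 - q * (2 * cos a)) * y (Suc i)"
    proof (rule path_q_laplacian_left_eigenvector[OF n _ _ _ that])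
      fix j
      have "y j + y (Suc (Suc j)) = sin (a * (real (Suc j) - s) - a) + sin (a * (real (Suc j) - s) + a)"
        by (simp add: y_def algebra_simps)
      then show "y j + y (Suc (Suc j)) = 2 * cos a * y (Suc j)"
        by (simp add: y_def sin_add sin_diff)
    next
      show "y 0 = - (q * (\<omega>\<^sub>1 - 1)) * y 1"
        using sin_wall[OF walls(1) q, of a] by (simp add: y_def)
    next
      \<comment> \<open>By the choice of \<open>t\<close>, reading a wave from the right wall instead of the left one
        changes at most its sign.\<close>
      have refl: "sin (a * (real n + 1 - r - s)) = - ((-1) ^ k) * sin (a * (r - s'))" for r
      proof -
        have "a * (real n + 1 - r - s) = real k * (pi - t * (r - s'))"
          unfolding a_def t[symmetric] by (simp add: algebra_simps)
        then show ?thesis by (simp only: sin_mult_supplement a_def mult.assoc)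
      qed
      have "y (Suc n) = - ((-1) ^ k) * sin (a * (0 - s'))"
        using refl[of 0] by (simp add: y_def add_ac)
      moreover have "y n = - ((-1) ^ k) * sin (a * (1 - s'))"
        using refl[of 1] by (simp add: y_def)
      ultimately show "y (Suc n) = - (q * (\<omega>\<^sub>2 - 1)) * y n"
        by (simp only: sin_wall[OF walls(2) q]) simp
    qed
    then show ?thesis by (simp add: y_Suc ev_def a_def)
  qed
  obtain u v \<tau> \<gamma> where uv: "u < n" "v < n" "u \<noteq> v" and \<tau>: "\<tau> > 0"
    and rel: "\<forall>x \<mu>. (\<forall>k<n. (\<Sum>j<n. x j * ?L $$ (j, k)) = \<mu> * x k) \<longrightarrow>
        cis (\<tau> * \<mu>) * complex_of_real (x u) = \<gamma> * complex_of_real (x v)"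
    by (rule vertex_PST_eigenvector_relation[OF path_q_laplacian_carrier pst])
  have relk: "cis (\<tau> * ev k) * complex_of_real (sin (real k * \<alpha> u))
      = \<gamma> * complex_of_real (sin (real k * \<alpha> v))" for k
    using rel[rule_format, of "\<lambda>j. sin (real k * \<alpha> j)" "ev k"] eig by simp
  have relk_abs: "\<bar>sin (real k * \<alpha> u)\<bar> = cmod \<gamma> * \<bar>sin (real k * \<alpha> v)\<bar>" for k
    using arg_cong[OF relk[of k], of cmod] by (simp add: norm_mult)
  have \<alpha>_range: "0 < \<alpha> j" "\<alpha> j < pi" if "j < n" for j
  proof -
    show "0 < \<alpha> j" using tpos s by (auto simp: \<alpha>_def)
    show "\<alpha> j < pi" unfolding \<alpha>_def t[symmetric] using tpos s that by auto
  qed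
  have "\<alpha> u \<noteq> \<alpha> v" using uv tpos by (auto simp: \<alpha>_def)
  then have mirror: "\<alpha> v = pi - \<alpha> u"
    using sin_abs_ratio_supplement[of "\<alpha> u" "\<alpha> v" "cmod \<gamma>"] \<alpha>_range uv relk_abs[of 1] relk_abs[of 2]
    by simp
  have "t * (real u + real v + 1) = t * (real n + s - s')"
    using mirror unfolding \<alpha>_def t[symmetric] by (simp add: algebra_simps)
  then have pos: "real u + real v + 1 = real n + s - s'" using tpos by simp
  define c where "c = pi / (\<tau> * q)"
  have phase: "cis (2 * (\<tau> * ev k)) = \<gamma>\<^sup>2" if "sin (real k * \<alpha> u) \<noteq> 0" for k
  proof -
    have "cis (\<tau> * ev k) * complex_of_real (sin (real k * \<alpha> u))
        = \<gamma> * of_real (- ((-1) ^ k)) * complex_of_real (sin (real k * \<alpha> u))"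
      using relk[of k] unfolding mirror sin_mult_supplement by simp
    then have "cis (\<tau> * ev k) = \<gamma> * of_real (- ((-1) ^ k))"
      using that by (simp only: mult_cancel_right of_real_eq_0_iff) simp
    then have "(cis (\<tau> * ev k))\<^sup>2 = \<gamma>\<^sup>2" by (simp add: power_mult_distrib flip: power_mult)
    then show ?thesis by (simp add: DeMoivre)
  qed
  have comm: "\<exists>m::int. 2 * cos (real k * t) - 2 * cos (real l * t) = of_int m * c"
    if "sin (real k * \<alpha> u) \<noteq> 0" "sin (real l * \<alpha> u) \<noteq> 0" for k l
  proof -
    have "cis (2 * (\<tau> * ev l) - 2 * (\<tau> * ev k)) = 1"
      using phase[OF that(1)] phase[OF that(2)] by (metis cis_divide cis_neq_zero divide_self)
    then obtain m :: int where "2 * (\<tau> * ev l) - 2 * (\<tau> * ev k) = of_int m * (2 * pi)"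
      unfolding cis_eq_1_iff by blast
    then have "(\<tau> * q) * (2 * cos (real k * t) - 2 * cos (real l * t)) = of_int m * pi"
      by (simp add: ev_def algebra_simps)
    then show ?thesis
      using \<tau> q by (intro exI[of _ m]) (simp add: c_def field_simps)
  qed
  have "c \<noteq> 0" using \<tau> q by (simp add: c_def)
  with uv pos comm show ?thesis unfolding \<alpha>_def by (intro that) blast+
qed

section \<open>Commensurable eigenvalues force rationality\<close>

lemma divide_int_multiples_Rats:
  fixes c :: real
  assumes "a = of_int k * c" "b = of_int l * c" "c \<noteq> 0"
  shows "a / b \<in> \<rat>"
  using assms by simp

lemma two_cos_multiples:
  fixes t :: real
  defines "x \<equiv> 2 * cos t"
  shows "2 * cos (2 * t) = x\<^sup>2 - 2" "2 * cos (3 * t) = x ^ 3 - 3 * x"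
    "2 * cos (4 * t) = x ^ 4 - 4 * x\<^sup>2 + 2" "2 * cos (5 * t) = x ^ 5 - 5 * x ^ 3 + 5 * x"
proof -
  have rec: "2 * cos (real (Suc (Suc k)) * t) = x * (2 * cos (real (Suc k) * t)) - 2 * cos (real k * t)" for k
    unfolding x_def by (rule two_cos_step)
  have x: "2 * cos t = x" by (simp add: x_def)
  show c2: "2 * cos (2 * t) = x\<^sup>2 - 2"
    using rec[of 0] x by (simp add: power2_eq_square)
  show c3: "2 * cos (3 * t) = x ^ 3 - 3 * x"
  proof -
    have "2 * cos (3 * t) = x * (2 * cos (2 * t)) - 2 * cos t" using rec[of 1] by simp
    then show ?thesis unfolding c2 x by (simp add: eval_nat_numeral algebra_simps)
  qed
  show c4: "2 * cos (4 * t) = x ^ 4 - 4 * x\<^sup>2 + 2"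
  proof -
    have "2 * cos (4 * t) = x * (2 * cos (3 * t)) - 2 * cos (2 * t)" using rec[of 2] by simp
    then show ?thesis unfolding c2 c3 by (simp add: eval_nat_numeral algebra_simps)
  qed
  show "2 * cos (5 * t) = x ^ 5 - 5 * x ^ 3 + 5 * x"
  proof -
    have "2 * cos (5 * t) = x * (2 * cos (4 * t)) - 2 * cos (3 * t)" using rec[of 3] by simp
    then show ?thesis unfolding c3 c4 by (simp add: eval_nat_numeral algebra_simps)
  qed
qed

text \<open>
  The three differences, for the waves 1, 2, 3, 5, share the factor \<open>2 - x\<close>. The quotient of the last two
  is \<open>x\<^sup>2 - 1\<close>, so \<open>x\<^sup>2\<close> is rational; then the quotient \<open>r\<close> of the first two gives a linear
  equation for \<open>x\<close> with rational coefficients, which degenerates only if \<open>x\<^sup>2 = 2\<close>.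
\<close>

lemma commensurable_differences_imp_Rats:
  fixes x c :: real and l m p :: int
  assumes x: "0 < x" "x < 2" "2 < x\<^sup>2" and c: "c \<noteq> 0"
    and d2: "x - (x\<^sup>2 - 2) = of_int l * c"
    and d3: "x - (x ^ 3 - 3 * x) = of_int m * c"
    and d5: "x - (x ^ 5 - 5 * x ^ 3 + 5 * x) = of_int p * c"
  shows "x \<in> \<rat>"
proof -
  have f2: "x - (x\<^sup>2 - 2) = (2 - x) * (x + 1)"
    and f3: "x - (x ^ 3 - 3 * x) = (2 - x) * (x * (x + 2))"
    and f5: "x - (x ^ 5 - 5 * x ^ 3 + 5 * x) = (2 - x) * (x * (x + 2)) * (x\<^sup>2 - 1)"
    by (simp_all add: eval_nat_numeral algebra_simps)
  have "(x - (x ^ 5 - 5 * x ^ 3 + 5 * x)) / (x - (x ^ 3 - 3 * x)) \<in> \<rat>"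
    by (rule divide_int_multiples_Rats[OF d5 d3 c])
  then have "x\<^sup>2 - 1 \<in> \<rat>" unfolding f5 f3 using x by simp
  then have sq: "x\<^sup>2 \<in> \<rat>" using Rats_add[of "x\<^sup>2 - 1" 1] by simp
  define r where "r = x * (x + 2) / (x + 1)"
  have "(x - (x ^ 3 - 3 * x)) / (x - (x\<^sup>2 - 2)) \<in> \<rat>"
    by (rule divide_int_multiples_Rats[OF d3 d2 c])
  then have r: "r \<in> \<rat>" unfolding f3 f2 r_def using x by simp
  have eq: "x\<^sup>2 + 2 * x = r * (x + 1)"
  proof -
    have "r * (x + 1) = x * (x + 2)" using x by (simp add: r_def)
    then show ?thesis by (simp add: power2_eq_square algebra_simps)
  qed
  then have "r \<noteq> 2" using x by auto
  moreover have "x * (2 - r) = r - x\<^sup>2" using eq by (simp add: algebra_simps)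
  ultimately have "x = (r - x\<^sup>2) / (2 - r)" by (simp add: eq_divide_eq)
  with r sq show ?thesis by (metis Rats_diff Rats_divide Rats_number_of)
qed

text \<open>
  The waves 1 and 2 make \<open>r = (x\<^sup>2 - 2) / x\<close> rational, and the bounds on \<open>x\<close> give \<open>0 < r < 1\<close>.
  The relation \<open>x\<^sup>2 = r x + 2\<close> then makes \<open>x\<close> rational: wave 3 shows that \<open>x\<^sup>2\<close> is rational,
  and wave 4 reduces to a linear equation for \<open>x\<close> with constant term \<open>2 - 2 r\<^sup>2 \<noteq> 0\<close>.
\<close>

lemma commensurable_values_imp_Rats:
  fixes x c :: real and k l m :: int
  assumes x: "0 < x" "x < 2" "2 < x\<^sup>2" and c: "c \<noteq> 0"
    and v1: "x = of_int k * c" and v2: "x\<^sup>2 - 2 = of_int l * c"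
    and v34: "x ^ 3 - 3 * x = of_int m * c \<or> x ^ 4 - 4 * x\<^sup>2 + 2 = of_int m * c"
  shows "x \<in> \<rat>"
proof -
  define r where "r = (x\<^sup>2 - 2) / x"
  have r: "r \<in> \<rat>" unfolding r_def by (rule divide_int_multiples_Rats[OF v2 v1 c])
  have xr: "x\<^sup>2 - 2 = r * x" using x by (simp add: r_def)
  have "0 < r" using x by (simp add: r_def)
  have "(x - 2) * (x + 1) < 0" using x by (intro mult_neg_pos) auto
  then have "r * x < 1 * x" unfolding xr[symmetric] by (simp add: power2_eq_square algebra_simps)
  then have "r < 1" using x by (simp add: mult_less_cancel_right)
  from v34 show ?thesis
  proof
    assume "x ^ 3 - 3 * x = of_int m * c"
    then have "(x ^ 3 - 3 * x) / x \<in> \<rat>" using v1 c by (rule divide_int_multiples_Rats)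
    also have "(x ^ 3 - 3 * x) / x = x\<^sup>2 - 3"
      using x by (simp add: field_simps eval_nat_numeral)
    finally have "x\<^sup>2 - 3 + 1 \<in> \<rat>" by (intro Rats_add) auto
    then have "x\<^sup>2 - 2 \<in> \<rat>" by simp
    then have "(x\<^sup>2 - 2) / r \<in> \<rat>" using r by (intro Rats_divide) auto
    then show ?thesis using xr \<open>0 < r\<close> by simp
  next
    assume v4: "x ^ 4 - 4 * x\<^sup>2 + 2 = of_int m * c"
    define w where "w = (x ^ 4 - 4 * x\<^sup>2 + 2) / x"
    have w: "w \<in> \<rat>" unfolding w_def by (rule divide_int_multiples_Rats[OF v4 v1 c])
    have "w * x = x ^ 4 - 4 * x\<^sup>2 + 2" using x by (simp add: w_def)
    also have "\<dots> = (x\<^sup>2 - 2)\<^sup>2 - 2" by (simp add: eval_nat_numeral algebra_simps)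
    also have "\<dots> = r\<^sup>2 * (r * x + 2) - 2" 
      using xr by (simp add: power_mult_distrib algebra_simps)
    finally have "x * (r ^ 3 - w) = 2 * (1 - r\<^sup>2)"
      by (simp add: eval_nat_numeral algebra_simps)
    moreover have "r\<^sup>2 < 1" using \<open>0 < r\<close> \<open>r < 1\<close> by (simp add: power_less_one_iff)
    ultimately have "x = 2 * (1 - r\<^sup>2) / (r ^ 3 - w)" by (auto simp: eq_divide_eq)
    moreover have "2 * (1 - r\<^sup>2) / (r ^ 3 - w) \<in> \<rat>"
      using r w by (intro Rats_divide Rats_mult Rats_diff Rats_power) auto
    ultimately show ?thesis by simp
  qed
qed

section \<open>The three families of paths\<close>

text \<open>
  The walls are at distance \<open>n + 1/2\<close>, so the mirror image of a vertex lies halfway between two sites.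
\<close>

lemma no_PST_unequal_walls:
  assumes "q \<noteq> 0" "n \<ge> 2"
  shows "\<not> vertex_PST (path_q_laplacian q n (1 + 1 / q) 1)"
proof
  assume pst: "vertex_PST (path_q_laplacian q n (1 + 1 / q) 1)"
  have walls: "wall q (1 + 1 / q) (1 / 2)" "wall q 1 0" by (simp_all add: wall_def)
  have t: "pi / (real n + 1 / 2) * (real n + 1 - 1 / 2 - 0) = pi" by (simp add: field_simps)
  obtain u v :: nat where "real u + real v + 1 = real n + 1 / 2 - 0"
    by (rule path_PST_mirror_commensurable[OF assms walls t pst])
  then have "real (2 * (u + v + 1)) = real (2 * n + 1)" by simp
  then have "2 * (u + v + 1) = 2 * n + 1" by (rule of_nat_eq_iff[THEN iffD1])
  then show False by presburger
qed

text \<open>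
  The spectrum is symmetric: if wave \<open>k\<close> does not vanish at \<open>u\<close>, nor does wave \<open>k + n + 1\<close>, and
  \<open>\<theta>\<close> changes its sign. Hence not only the differences but the values \<open>\<theta>\<^sub>k\<close>
  themselves are commensurable. Waves 1 and 2 never vanish at \<open>u\<close> because \<open>u\<close> is not its own mirror
  image, and waves 3 and 4 cannot both vanish there because then wave 1 would.
\<close>

lemma no_PST_zero_walls:
  assumes q: "q \<noteq> 0" and n: "n \<ge> 4"
  shows "\<not> vertex_PST (path_q_laplacian q n 1 1)"
proof
  assume pst: "vertex_PST (path_q_laplacian q n 1 1)"
  define t where "t = pi / real (n + 1)"
  define x where "x = 2 * cos t"
  have walls: "wall q 1 0" by (simp add: wall_def)
  have t: "t * (real n + 1 - 0 - 0) = pi" by (simp add: t_def field_simps)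
  have "n \<ge> 2" using n by simp
  obtain u v c where "u < n" "v < n" "u \<noteq> v" "real u + real v + 1 = real n + 0 - 0" and c: "c \<noteq> 0"
    and comm0: "\<forall>k l. sin (real k * (t * (real u + 1 - 0))) \<noteq> 0 \<longrightarrow>
           sin (real l * (t * (real u + 1 - 0))) \<noteq> 0 \<longrightarrow>
        (\<exists>m::int. 2 * cos (real k * t) - 2 * cos (real l * t) = of_int m * c)"
    by (rule path_PST_mirror_commensurable[OF q \<open>n \<ge> 2\<close> walls walls t pst])
  then have uv: "u < n" "v < n" "u \<noteq> v" "u + v + 1 = n" by linarith+
  note comm = comm0[unfolded diff_0_right, rule_format]
  have support: "sin (real k * (t * (real u + 1))) \<noteq> 0" if "\<not> (n + 1) dvd k * (u + 1)" for k
  proof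
    assume "sin (real k * (t * (real u + 1))) = 0"
    then obtain i :: int where "real k * (t * (real u + 1)) = of_int i * pi"
      unfolding sin_zero_iff_int2 by blast
    then have "pi * (real k * (real u + 1)) = pi * (of_int i * real (n + 1))"
      by (simp add: t_def field_simps)
    then have "real (k * (u + 1)) = of_int i * real (n + 1)"
      by (simp only: mult_cancel_left pi_neq_zero) (simp add: algebra_simps)
    then have "of_int (int (k * (u + 1))) = (of_int (i * int (n + 1)) :: real)"
      by simp
    then have "int (k * (u + 1)) = i * int (n + 1)" by (simp only: of_int_eq_iff)
    then have "int (n + 1) dvd int (k * (u + 1))" by simp
    with that show False by (simp only: int_dvd_int_iff)
  qed
  have val: "\<exists>m::int. 2 * cos (real k * t) = of_int m * (c / 2)"
    if k: "\<not> (n + 1) dvd k * (u + 1)" for k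
  proof -
    have "\<not> (n + 1) dvd (k + (n + 1)) * (u + 1)"
      using k by (simp only: distrib_right[of k] dvd_add_left_iff[OF dvd_triv_left]) simp
    from comm[OF support[OF k] support[OF this]] obtain m :: int
      where "2 * cos (real k * t) - 2 * cos (real (k + (n + 1)) * t) = of_int m * c" by blast
    moreover have "real (k + (n + 1)) * t = real k * t + pi"
      by (simp add: t_def field_simps)
    ultimately show ?thesis by (intro exI[of _ m]) simp
  qed
  have n1: "\<not> (n + 1) dvd 1 * (u + 1)" using uv by (auto dest: dvd_imp_le)
  have n2: "\<not> (n + 1) dvd 2 * (u + 1)"
  proof
    assume "(n + 1) dvd 2 * (u + 1)"
    then obtain i where i: "2 * (u + 1) = (n + 1) * i" by (elim dvdE)
    have "i \<noteq> 0" using i by (intro notI) simp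
    moreover have "(n + 1) * i < (n + 1) * 2" unfolding i[symmetric] using uv(1) by simp
    then have "i < 2" by (simp only: mult_less_cancel1)
    ultimately have "i = 1" by simp
    with i uv show False by auto
  qed
  have n34: "\<not> (n + 1) dvd 3 * (u + 1) \<or> \<not> (n + 1) dvd 4 * (u + 1)"
  proof (rule ccontr)
    assume "\<not> ?thesis"
    then have "(n + 1) dvd 4 * (u + 1) - 3 * (u + 1)" by (intro dvd_diff_nat) auto
    with n1 show False by simp
  qed
  have b: "0 < x" "x < 2" "2 < x\<^sup>2" and irr: "x \<notin> \<rat>"
    using two_cos_pi_div_bounds[of "n + 1"] two_cos_pi_div_irrational[of "n + 1"] n
    by (auto simp: x_def t_def)
  obtain m1 m2 :: int where m1: "x = of_int m1 * (c / 2)" and m2: "x\<^sup>2 - 2 = of_int m2 * (c / 2)"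
    using val[OF n1] val[OF n2] two_cos_multiples[of t] by (auto simp: x_def)
  obtain m :: int where "x ^ 3 - 3 * x = of_int m * (c / 2) \<or> x ^ 4 - 4 * x\<^sup>2 + 2 = of_int m * (c / 2)"
    using n34 val[of 3] val[of 4] two_cos_multiples[of t] by (auto simp: x_def)
  from commensurable_values_imp_Rats[OF b _ m1 m2 this] c irr show False by simp
qed

text \<open>
  A wave of odd index vanishes at no vertex, by parity, and wave 2 only at a vertex that is its own
  mirror image. So the waves 1, 2, 3 and 5 are available at \<open>u\<close>.
\<close>

lemma no_PST_half_walls:
  assumes q: "q \<noteq> 0" and n: "n \<ge> 5"
  shows "\<not> vertex_PST (path_q_laplacian q n (1 + 1 / q) (1 + 1 / q))"
proof
  assume pst: "vertex_PST (path_q_laplacian q n (1 + 1 / q) (1 + 1 / q))"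
  define t where "t = pi / real n"
  define x where "x = 2 * cos t"
  have walls: "wall q (1 + 1 / q) (1 / 2)" by (simp add: wall_def)
  have t: "t * (real n + 1 - 1 / 2 - 1 / 2) = pi" using n by (simp add: t_def)
  have "n \<ge> 2" using n by simp
  obtain u v c where "u < n" "v < n" "u \<noteq> v" "real u + real v + 1 = real n + 1 / 2 - 1 / 2"
    and c: "c \<noteq> 0"
    and comm0: "\<forall>k l. sin (real k * (t * (real u + 1 - 1 / 2))) \<noteq> 0 \<longrightarrow>
           sin (real l * (t * (real u + 1 - 1 / 2))) \<noteq> 0 \<longrightarrow>
        (\<exists>m::int. 2 * cos (real k * t) - 2 * cos (real l * t) = of_int m * c)"
    by (rule path_PST_mirror_commensurable[OF q \<open>n \<ge> 2\<close> walls walls t pst])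
  then have uv: "u < n" "v < n" "u \<noteq> v" "u + v + 1 = n" by linarith+
  have "real u + 1 - 1 / 2 = real u + 1 / 2" by simp
  note comm = comm0[unfolded this, rule_format]
  have zero: "\<exists>i::int. int k * (2 * int u + 1) = 2 * i * int n"
    if "sin (real k * (t * (real u + 1 / 2))) = 0" for k
  proof -
    obtain i :: int where "real k * (t * (real u + 1 / 2)) = of_int i * pi"
      using \<open>sin (real k * (t * (real u + 1 / 2))) = 0\<close> unfolding sin_zero_iff_int2 by blast
    then have "pi * (real k * (2 * real u + 1)) = pi * (2 * of_int i * real n)"
      using n by (simp add: t_def field_simps)
    then have "real k * (2 * real u + 1) = 2 * of_int i * real n"
      by (simp only: mult_cancel_left pi_neq_zero) simp
    then have "real_of_int (int k * (2 * int u + 1)) = of_int (2 * i * int n)" by simp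
    then show ?thesis by (metis of_int_eq_iff)
  qed
  have odd: "sin (real k * (t * (real u + 1 / 2))) \<noteq> 0" if "odd k" for k
  proof
    assume "sin (real k * (t * (real u + 1 / 2))) = 0"
    then obtain i where "int k * (2 * int u + 1) = 2 * i * int n" using zero by blast
    moreover have "odd (int k * (2 * int u + 1))" using that by simp
    ultimately show False by simp
  qed
  have two: "sin (real 2 * (t * (real u + 1 / 2))) \<noteq> 0"
  proof
    assume "sin (real 2 * (t * (real u + 1 / 2))) = 0"
    then obtain i where "int 2 * (2 * int u + 1) = 2 * i * int n" using zero by blast
    then have i: "2 * int u + 1 = i * int n" by simp
    then have "0 < i * int n" "i * int n < 2 * int n" using uv by linarith+
    then have "i = 1" by (auto simp: zero_less_mult_iff)
    with i have "2 * u + 1 = n" by simp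
    with uv show False by linarith
  qed
  have b: "0 < x" "x < 2" "2 < x\<^sup>2" and irr: "x \<notin> \<rat>"
    using two_cos_pi_div_bounds[of n] two_cos_pi_div_irrational[of n] n
    by (auto simp: x_def t_def)
  obtain m2 m3 m5 :: int where "x - (x\<^sup>2 - 2) = of_int m2 * c"
    "x - (x ^ 3 - 3 * x) = of_int m3 * c" "x - (x ^ 5 - 5 * x ^ 3 + 5 * x) = of_int m5 * c"
    using comm[OF odd[of 1] two] comm[OF odd[of 1] odd[of 3]] comm[OF odd[of 1] odd[of 5]]
      two_cos_multiples[of t] by (auto simp: x_def)
  from commensurable_differences_imp_Rats[OF b c this] irr show False by contradiction
qed

theorem theorem11:
  fixes q \<omega>\<^sub>1 \<omega>\<^sub>2 :: real and n :: nat
  assumes "q \<noteq> 0"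
    and "(n \<ge> 2 \<and> \<omega>\<^sub>1 = 1 + 1 / q \<and> \<omega>\<^sub>2 = 1)
       \<or> (n \<ge> 4 \<and> \<omega>\<^sub>1 = 1 \<and> \<omega>\<^sub>2 = 1)
       \<or> (n \<ge> 5 \<and> \<omega>\<^sub>1 = 1 + 1 / q \<and> \<omega>\<^sub>2 = 1 + 1 / q)"
  shows "\<not> vertex_PST (path_q_laplacian q n \<omega>\<^sub>1 \<omega>\<^sub>2)"
  using assms no_PST_unequal_walls no_PST_zero_walls no_PST_half_walls by blast

end
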